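(* Let $R$ be a commutative ring and let $X$ be a dg algebra over $R$. Consider a deformation retract of complexes of $R$-modules $$i\colon (Y,\partial^Y)\to (X,\partial^X),\qquad p\colon (X,\partial^X)\to (Y,\partial^Y),$$ with associated homotopy $h$ on $X$, such that $h$ satisfies the generalized Leibniz rule and $hi=0$. Then the product $$\alpha\beta := p\bigl(i(\alpha)\,i(\beta)\bigr)\qquad\text{for } \alpha,\beta\in Y,$$ where the product inside the parentheses is the one in $X$, defines a dg algebra structure on $Y$. Moreover, with this structure on $Y$, the map $i$ is a homomorphism of dg algebras.
   Context: Complexes are complexes of $R$-modules, graded homologically (differentials have degree $-1$). A dg algebra over $R$ is a complex $(X,\partial)$ of $R$-modules concentrated in nonnegative degrees, equipped with a product given by a chain map $X\otimes_R X\to X$, $\alpha\otimes\beta\mapsto\alpha\beta$, that is associative and unitary with $1\in X_0$. That the product is a chain map is equivalent to the Leibniz rule $\partial(\alpha\beta)=\partial(\alpha)\beta+(-1)^{|\alpha|}\alpha\partial(\beta)$. The product is also assumed strictly graded commutative: $\alpha\beta=(-1)^{|\alpha||\beta|}\beta\alpha$, and $\alpha^2=0$ if $|\alpha|$ is odd. A homomorphism of dg algebras is a morphism of complexes $\phi$ with $\phi(1)=1$ and $\phi(\alpha\beta)=\phi(\alpha)\phi(\beta)$. A deformation retract consists of quasi-isomorphisms of complexes $i\colon Y\to X$ and $p\colon X\to Y$ together with a chosen homotopy $h$ on $X$ (an $R$-linear graded map $X\to X$ of degree $1$) such that $ip=1+\partial^X h+h\partial^X$ and $pi=1$. A graded map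 $h\colon X\to X$ (not necessarily a chain map) satisfies the generalized Leibniz rule if $h(\alpha\beta)\in h(\alpha)X+Xh(\beta)$ for all $\alpha,\beta\in X$.
   Formalization: The hypothesis h(1)=0 is added: without it the claim fails (X=R⊕Rt with R≠0, |t|=1, ∂t=1, Y=0, h(1)=-t, h(t)=0, where i(1)≠1). It is necessary, since i(1)=1 and hi=0 force h(1)=0. *)

theory Defs
  imports "HOL-Algebra.Module" "HOL-Algebra.AbelCoset"
begin

definition lin_hom ::
    "('a, 'm) ring_scheme \<Rightarrow> ('a, 'x, 'k) module_scheme \<Rightarrow> ('a, 'y, 'l) module_scheme \<Rightarrow> ('x \<Rightarrow> 'y) set"
  where "lin_hom R M N = {f \<in> carrier M \<rightarrow> carrier N.
    (\<forall>x\<in>carrier M. \<forall>y\<in>carrier M. f (x \<oplus>\<^bsub>M\<^esub> y) = f x \<oplus>\<^bsub>N\<^esub> f y) \<and>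
    (\<forall>a\<in>carrier R. \<forall>x\<in>carrier M. f (a \<odot>\<^bsub>M\<^esub> x) = a \<odot>\<^bsub>N\<^esub> f x)}"

section \<open>Complexes and quasi-isomorphisms\<close>

text \<open>A graded module is an \<open>\<int>\<close>-indexed family of modules.  Elements are homogeneous, and a graded
  map is the family of its components, so everything is relative to the carriers
  \<open>carrier (deg X n)\<close>; the carriers for different \<open>n\<close> need not be disjoint.\<close>

record ('a, 'x) cplx =
  deg :: "int \<Rightarrow> ('a, 'x) module"
  dif :: "int \<Rightarrow> 'x \<Rightarrow> 'x"

locale chain_complex =
  fixes R :: "('a, 'm) ring_scheme" and X :: "('a, 'x) cplx"
  assumes deg_module: "\<And>n. module R (deg X n)"
    and dif_hom: "\<And>n. dif X n \<in> lin_hom R (deg X n) (deg X (n - 1))"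
    and dif_dif: "\<And>n x. x \<in> carrier (deg X n) \<Longrightarrow> dif X (n - 1) (dif X n x) = \<zero>\<^bsub>deg X (n - 2)\<^esub>"

locale chain_map = X: chain_complex R X + Y: chain_complex R Y
  for R :: "('a, 'm) ring_scheme" and X :: "('a, 'x) cplx" and Y :: "('a, 'y) cplx" +
  fixes \<phi> :: "int \<Rightarrow> 'x \<Rightarrow> 'y"
  assumes map_hom: "\<And>n. \<phi> n \<in> lin_hom R (deg X n) (deg Y n)"
    and map_dif: "\<And>n x. x \<in> carrier (deg X n) \<Longrightarrow> \<phi> (n - 1) (dif X n x) = dif Y n (\<phi> n x)"

definition cycles :: "('a, 'x) cplx \<Rightarrow> int \<Rightarrow> 'x set"
  where "cycles X n = {x \<in> carrier (deg X n). dif X n x = \<zero>\<^bsub>deg X (n - 1)\<^esub>}"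

definition boundaries :: "('a, 'x) cplx \<Rightarrow> int \<Rightarrow> 'x set"
  where "boundaries X n = dif X (n + 1) ` carrier (deg X (n + 1))"

definition homology :: "('a, 'x) cplx \<Rightarrow> int \<Rightarrow> 'x set monoid"
  where "homology X n = (add_monoid (deg X n))\<lparr>carrier := cycles X n\<rparr> Mod boundaries X n"

text \<open>The value on a class is the common class of the images of its representatives.\<close>

definition homology_map ::
    "('a, 'y) cplx \<Rightarrow> (int \<Rightarrow> 'x \<Rightarrow> 'y) \<Rightarrow> int \<Rightarrow> 'x set \<Rightarrow> 'y set"
  where "homology_map Y \<phi> n C = the_elem ((\<lambda>z. boundaries Y n +>\<^bsub>deg Y n\<^esub> \<phi> n z) ` C)"

text \<open>The map on homology induced by a chain map is automatically \<open>R\<close>-linear, so it is an isomorphism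
  of modules as soon as it is one of the underlying groups.\<close>

locale quasi_iso = chain_map +
  assumes homology_iso: "\<And>n. homology_map Y \<phi> n \<in> iso (homology X n) (homology Y n)"

locale deformation_retract =
  i: quasi_iso R Y X i + p: quasi_iso R X Y p
  for R :: "('a, 'm) ring_scheme" and X :: "('a, 'x) cplx" and Y :: "('a, 'y) cplx"
    and i :: "int \<Rightarrow> 'y \<Rightarrow> 'x" and p :: "int \<Rightarrow> 'x \<Rightarrow> 'y" +
  fixes h :: "int \<Rightarrow> 'x \<Rightarrow> 'x"
  assumes h_hom: "\<And>n. h n \<in> lin_hom R (deg X n) (deg X (n + 1))"
    and i_p: "\<And>n x. x \<in> carrier (deg X n) \<Longrightarrow>
      i n (p n x) = x \<oplus>\<^bsub>deg X n\<^esub> dif X (n + 1) (h n x) \<oplus>\<^bsub>deg X n\<^esub> h (n - 1) (dif X n x)"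
    and p_i: "\<And>n y. y \<in> carrier (deg Y n) \<Longrightarrow> p n (i n y) = y"

section \<open>Differential graded algebras\<close>

definition ksign :: "('a, 'x, 'k) module_scheme \<Rightarrow> int \<Rightarrow> 'x \<Rightarrow> 'x"
  where "ksign M k x = (if even k then x else \<ominus>\<^bsub>M\<^esub> x)"

text \<open>\<open>\<mu> m n\<close> is the component \<open>X\<^sub>m \<times> X\<^sub>n \<rightarrow> X\<^bsub>m+n\<^esub>\<close> of the product.  A chain map
  \<open>X \<otimes> X \<rightarrow> X\<close> is given by the bilinear maps \<open>\<mu> m n\<close> subject to the Leibniz rule.\<close>

locale dg_algebra = chain_complex R X
  for R :: "('a, 'm) ring_scheme" and X :: "('a, 'x) cplx" +
  fixes \<mu> :: "int \<Rightarrow> int \<Rightarrow> 'x \<Rightarrow> 'x \<Rightarrow> 'x" and e :: 'x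
  assumes nonneg: "\<And>n. n < 0 \<Longrightarrow> carrier (deg X n) = {\<zero>\<^bsub>deg X n\<^esub>}"
    and mult_hom_right: "\<And>m n x. x \<in> carrier (deg X m) \<Longrightarrow>
      \<mu> m n x \<in> lin_hom R (deg X n) (deg X (m + n))"
    and mult_hom_left: "\<And>m n y. y \<in> carrier (deg X n) \<Longrightarrow>
      (\<lambda>x. \<mu> m n x y) \<in> lin_hom R (deg X m) (deg X (m + n))"
    and leibniz: "\<And>m n x y. \<lbrakk>x \<in> carrier (deg X m); y \<in> carrier (deg X n)\<rbrakk> \<Longrightarrow>
      dif X (m + n) (\<mu> m n x y) =
        \<mu> (m - 1) n (dif X m x) y
        \<oplus>\<^bsub>deg X (m + n - 1)\<^esub> ksign (deg X (m + n - 1)) m (\<mu> m (n - 1) x (dif X n y))"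
    and mult_assoc: "\<And>l m n x y z.
      \<lbrakk>x \<in> carrier (deg X l); y \<in> carrier (deg X m); z \<in> carrier (deg X n)\<rbrakk> \<Longrightarrow>
      \<mu> (l + m) n (\<mu> l m x y) z = \<mu> l (m + n) x (\<mu> m n y z)"
    and unit_closed: "e \<in> carrier (deg X 0)"
    and unit_left: "\<And>n x. x \<in> carrier (deg X n) \<Longrightarrow> \<mu> 0 n e x = x"
    and unit_right: "\<And>n x. x \<in> carrier (deg X n) \<Longrightarrow> \<mu> n 0 x e = x"
    and graded_comm: "\<And>m n x y. \<lbrakk>x \<in> carrier (deg X m); y \<in> carrier (deg X n)\<rbrakk> \<Longrightarrow>
      \<mu> m n x y = ksign (deg X (m + n)) (m * n) (\<mu> n m y x)"
    and odd_square: "\<And>n x. \<lbrakk>odd n; x \<in> carrier (deg X n)\<rbrakk> \<Longrightarrow> \<mu> n n x x = \<zero>\<^bsub>deg X (n + n)\<^esub>"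

locale dg_algebra_hom =
  X: dg_algebra R X \<mu> e + Y: dg_algebra R Y \<nu> f + chain_map R X Y \<phi>
  for R :: "('a, 'm) ring_scheme" and X :: "('a, 'x) cplx" and \<mu> e
    and Y :: "('a, 'y) cplx" and \<nu> f and \<phi> +
  assumes map_unit: "\<phi> 0 e = f"
    and map_mult: "\<And>m n x y. \<lbrakk>x \<in> carrier (deg X m); y \<in> carrier (deg X n)\<rbrakk> \<Longrightarrow>
      \<phi> (m + n) (\<mu> m n x y) = \<nu> m n (\<phi> m x) (\<phi> n y)"

text \<open>The condition \<open>h(\<alpha>\<beta>) \<in> h(\<alpha>)X + Xh(\<beta>)\<close> for homogeneous \<open>\<alpha>\<close>, \<open>\<beta>\<close>; the right-hand side is
  taken in degree \<open>|\<alpha>| + |\<beta>| + 1\<close>, which fixes the degrees of the cofactors.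
  Unlike the Leibniz rule, this does not imply \<open>h(1) = 0\<close>: for \<open>\<alpha> = 1\<close> or \<open>\<beta> = 1\<close> it is vacuous.
  For example, let \<open>X = R \<oplus> Rt\<close> with \<open>|t| = 1\<close> and \<open>\<partial>t = 1\<close>, and let \<open>Y = 0\<close>, \<open>h(1) = -t\<close>, \<open>h(t) = 0\<close>.\<close>

definition generalized_leibniz ::
    "('a, 'x) cplx \<Rightarrow> (int \<Rightarrow> int \<Rightarrow> 'x \<Rightarrow> 'x \<Rightarrow> 'x) \<Rightarrow> (int \<Rightarrow> 'x \<Rightarrow> 'x) \<Rightarrow> bool"
  where "generalized_leibniz X \<mu> h \<longleftrightarrow>
    (\<forall>m n. \<forall>x\<in>carrier (deg X m). \<forall>y\<in>carrier (deg X n).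
      \<exists>u\<in>carrier (deg X n). \<exists>v\<in>carrier (deg X m).
        h (m + n) (\<mu> m n x y) =
          \<mu> (m + 1) n (h m x) u \<oplus>\<^bsub>deg X (m + n + 1)\<^esub> \<mu> m (n + 1) v (h n y))"

definition transferred_mult ::
    "(int \<Rightarrow> int \<Rightarrow> 'x \<Rightarrow> 'x \<Rightarrow> 'x) \<Rightarrow> (int \<Rightarrow> 'y \<Rightarrow> 'x) \<Rightarrow> (int \<Rightarrow> 'x \<Rightarrow> 'y) \<Rightarrow>
      int \<Rightarrow> int \<Rightarrow> 'y \<Rightarrow> 'y \<Rightarrow> 'y"
  where "transferred_mult \<mu> i p m n a b = p (m + n) (\<mu> m n (i m a) (i n b))"

end

theory Submission
  imports Defs
begin

text \<open>By the generalized Leibniz rule and \<open>h i = 0\<close>, the homotopy \<open>h\<close> kills every product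
  \<open>i(a) i(b)\<close>; since \<open>i\<close> is a chain map, it also kills \<open>\<partial>(i(a) i(b))\<close>.  Hence \<open>i p = 1 + \<partial> h + h \<partial>\<close>
  fixes \<open>i(a) i(b)\<close>, and it fixes \<open>1\<close>.  So \<open>i\<close> identifies \<open>Y\<close> with a dg subalgebra of \<open>X\<close>, and
  applying \<open>p\<close> to the identities of \<open>X\<close> gives those of \<open>Y\<close>.\<close>

lemma lin_hom_closed: "f \<in> lin_hom R M N \<Longrightarrow> x \<in> carrier M \<Longrightarrow> f x \<in> carrier N"
  by (auto simp: lin_hom_def)

lemma lin_hom_add:
  "f \<in> lin_hom R M N \<Longrightarrow> x \<in> carrier M \<Longrightarrow> y \<in> carrier M \<Longrightarrow> f (x \<oplus>\<^bsub>M\<^esub> y) = f x \<oplus>\<^bsub>N\<^esub> f y"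
  by (auto simp: lin_hom_def)

lemma lin_hom_compose:
  "f \<in> lin_hom R L M \<Longrightarrow> g \<in> lin_hom R M N \<Longrightarrow> (\<lambda>x. g (f x)) \<in> lin_hom R L N"
  by (auto simp: lin_hom_def Pi_iff)

lemma lin_hom_zero:
  assumes f: "f \<in> lin_hom R M N" and "module R M" "module R N"
  shows "f \<zero>\<^bsub>M\<^esub> = \<zero>\<^bsub>N\<^esub>"
proof -
  interpret M: module R M by fact
  interpret N: module R N by fact
  have closed: "f \<zero>\<^bsub>M\<^esub> \<in> carrier N" using f by (rule lin_hom_closed) simp
  have "f \<zero>\<^bsub>M\<^esub> \<oplus>\<^bsub>N\<^esub> f \<zero>\<^bsub>M\<^esub> = f \<zero>\<^bsub>M\<^esub>"
    using lin_hom_add[OF f, of "\<zero>\<^bsub>M\<^esub>" "\<zero>\<^bsub>M\<^esub>"] by simp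
  then show ?thesis using closed by (metis N.add.r_cancel_one)
qed

lemma lin_hom_ksign:
  assumes f: "f \<in> lin_hom R M N" and "module R M" "module R N" and x: "x \<in> carrier M"
  shows "f (ksign M k x) = ksign N k (f x)"
proof -
  interpret M: module R M by fact
  interpret N: module R N by fact
  have "f (\<ominus>\<^bsub>M\<^esub> x) \<oplus>\<^bsub>N\<^esub> f x = \<zero>\<^bsub>N\<^esub>"
    using lin_hom_add[OF f, of "\<ominus>\<^bsub>M\<^esub> x" x] lin_hom_zero[OF assms(1-3)] x
    by (simp add: M.l_neg)
  then have "\<ominus>\<^bsub>N\<^esub> f x = f (\<ominus>\<^bsub>M\<^esub> x)"
    using x by (intro N.minus_equality) (auto intro: lin_hom_closed[OF f])
  then show ?thesis by (simp add: ksign_def)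
qed

lemma ksign_closed: "module R M \<Longrightarrow> x \<in> carrier M \<Longrightarrow> ksign M k x \<in> carrier M"
  by (simp add: ksign_def abelian_group.a_inv_closed module.axioms(2))

lemma ksign_zero: "module R M \<Longrightarrow> ksign M k \<zero>\<^bsub>M\<^esub> = \<zero>\<^bsub>M\<^esub>"
proof -
  assume "module R M"
  then interpret module R M .
  show ?thesis by (simp add: ksign_def)
qed

context chain_map
begin

lemma map_closed: "x \<in> carrier (deg X n) \<Longrightarrow> \<phi> n x \<in> carrier (deg Y n)"
  using map_hom by (rule lin_hom_closed)

lemma map_zero: "\<phi> n \<zero>\<^bsub>deg X n\<^esub> = \<zero>\<^bsub>deg Y n\<^esub>"
  using map_hom X.deg_module Y.deg_module by (rule lin_hom_zero)

end

lemma (in chain_complex) dif_closed: "x \<in> carrier (deg X n) \<Longrightarrow> dif X n x \<in> carrier (deg X (n - 1))"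
  using dif_hom by (rule lin_hom_closed)

lemma (in dg_algebra) mult_closed:
  "x \<in> carrier (deg X m) \<Longrightarrow> y \<in> carrier (deg X n) \<Longrightarrow> \<mu> m n x y \<in> carrier (deg X (m + n))"
  by (rule lin_hom_closed[OF mult_hom_right])

lemma (in dg_algebra) mult_zero_right:
  "x \<in> carrier (deg X m) \<Longrightarrow> \<mu> m n x \<zero>\<^bsub>deg X n\<^esub> = \<zero>\<^bsub>deg X (m + n)\<^esub>"
  using lin_hom_zero[OF mult_hom_right deg_module deg_module] .

lemma (in dg_algebra) mult_zero_left:
  "y \<in> carrier (deg X n) \<Longrightarrow> \<mu> m n \<zero>\<^bsub>deg X m\<^esub> y = \<zero>\<^bsub>deg X (m + n)\<^esub>"
  using lin_hom_zero[OF mult_hom_left deg_module deg_module] .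

text \<open>The homotopy enters the transfer only through the fixed points of \<open>i p\<close>.
  Once the unit and all products of elements from the image of \<open>i\<close> are fixed, that
  image is a dg subalgebra, and \<open>p\<close> restricts to the inverse of \<open>i\<close> on
  it.\<close>

locale dg_algebra_section =
  X: dg_algebra R X \<mu> e + i: chain_map R Y X i + p: chain_map R X Y p
  for R :: "('a, 'm) ring_scheme" and X :: "('a, 'x) cplx" and \<mu> e
    and Y :: "('a, 'y) cplx" and i p +
  assumes p_i: "\<And>n y. y \<in> carrier (deg Y n) \<Longrightarrow> p n (i n y) = y"
    and i_p_mult: "\<And>m n a b. \<lbrakk>a \<in> carrier (deg Y m); b \<in> carrier (deg Y n)\<rbrakk> \<Longrightarrow>
      i (m + n) (p (m + n) (\<mu> m n (i m a) (i n b))) = \<mu> m n (i m a) (i n b)"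
    and i_p_unit: "i 0 (p 0 e) = e"
begin

lemma transferred_dg_algebra: "dg_algebra R Y (transferred_mult \<mu> i p) (p 0 e)"
proof (unfold_locales, goal_cases)
  case (1 n)
  have "y = \<zero>\<^bsub>deg Y n\<^esub>" if y: "y \<in> carrier (deg Y n)" for y
  proof -
    \<comment> \<open>In negative degrees \<open>X\<close> vanishes; \<open>p i = 1\<close> makes
      \<open>i\<close> injective, so \<open>Y\<close> vanishes there too.\<close>
    have "i n y = \<zero>\<^bsub>deg X n\<^esub>" using i.map_closed[OF y] unfolding X.nonneg[OF 1] by simp
    then show ?thesis by (metis p_i[OF y] p.map_zero)
  qed
  moreover have "\<zero>\<^bsub>deg Y n\<^esub> \<in> carrier (deg Y n)"
    using p.map_closed[of "\<zero>\<^bsub>deg X n\<^esub>" n] unfolding X.nonneg[OF 1] p.map_zero by simp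
  ultimately show ?case by blast
next
  case (2 m n x)
  show ?case unfolding transferred_mult_def
    by (intro lin_hom_compose[OF lin_hom_compose[OF i.map_hom] p.map_hom]
        X.mult_hom_right i.map_closed 2)
next
  case (3 m n y)
  show ?case unfolding transferred_mult_def
    by (rule lin_hom_compose[OF lin_hom_compose[OF i.map_hom, of "\<lambda>x. \<mu> m n x (i n y)"] p.map_hom])
      (intro X.mult_hom_left i.map_closed 3)
next
  case (4 m n x y)
  let ?k = "m + n - 1"
  \<comment> \<open>The two Leibniz terms arise in degrees \<open>m - 1 + n\<close> and
    \<open>m + (n - 1)\<close>, and must be seen in the one module of degree \<open>?k\<close>
    before they can be added.\<close>
  have idx: "m - 1 + n = ?k" "m + (n - 1) = ?k" by auto
  note closed = 4[THEN i.map_closed] 4[THEN i.map_closed, THEN X.dif_closed]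
  have c1: "\<mu> (m - 1) n (dif X m (i m x)) (i n y) \<in> carrier (deg X ?k)"
    using X.mult_closed[OF closed(3,2)] by (simp add: idx)
  have c2: "\<mu> m (n - 1) (i m x) (dif X n (i n y)) \<in> carrier (deg X ?k)"
    using X.mult_closed[OF closed(1,4)] by (simp add: idx)
  have "dif Y (m + n) (p (m + n) (\<mu> m n (i m x) (i n y))) =
      p ?k (dif X (m + n) (\<mu> m n (i m x) (i n y)))"
    by (simp add: p.map_dif X.mult_closed closed)
  also have "\<dots> = p ?k (\<mu> (m - 1) n (dif X m (i m x)) (i n y))
      \<oplus>\<^bsub>deg Y ?k\<^esub> ksign (deg Y ?k) m (p ?k (\<mu> m (n - 1) (i m x) (dif X n (i n y))))"
    using c1 c2
    by (simp add: X.leibniz closed lin_hom_add[OF p.map_hom] ksign_closed[OF X.deg_module]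
        lin_hom_ksign[OF p.map_hom X.deg_module i.X.deg_module])
  \<comment> \<open>Since \<open>i\<close> is a chain map, the differentials taken in
    \<open>X\<close> become images of differentials in \<open>Y\<close>, which turns both terms into
    transferred products.\<close>
  finally show ?case using 4 by (simp add: transferred_mult_def idx i.map_dif)
next
  case (5 l m n x y z)
  \<comment> \<open>In each bracketing the inner \<open>i p\<close> disappears by
    \<open>i_p_mult\<close>; what remains is \<open>p\<close> of a triple product in
    \<open>X\<close>.\<close>
  then show ?case
    by (simp add: transferred_mult_def i_p_mult X.mult_assoc i.map_closed add.assoc)
next
  case 6
  show ?case by (rule p.map_closed[OF X.unit_closed])
next
  case (7 n x)
  then show ?case
    by (simp add: transferred_mult_def i_p_unit X.unit_left i.map_closed p_i)
next
  case (8 n x)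
  then show ?case
    by (simp add: transferred_mult_def i_p_unit X.unit_right i.map_closed p_i)
next
  case (9 m n x y)
  note closed = 9[THEN i.map_closed]
  have "\<mu> n m (i n y) (i m x) \<in> carrier (deg X (m + n))"
    using X.mult_closed[OF closed(2,1)] by (simp add: add.commute)
  then show ?case
    unfolding transferred_mult_def X.graded_comm[OF closed] add.commute[of n m]
    by (rule lin_hom_ksign[OF p.map_hom X.deg_module i.X.deg_module])
next
  case (10 n x)
  then show ?case by (simp add: transferred_mult_def X.odd_square i.map_closed p.map_zero)
qed

text \<open>Multiplicativity of \<open>i\<close> for the transferred product is exactly
  \<open>i_p_mult\<close>, read from right to left.\<close>

lemma section_dg_algebra_hom: "dg_algebra_hom R Y (transferred_mult \<mu> i p) (p 0 e) X \<mu> e i"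
proof -
  interpret Y: dg_algebra R Y "transferred_mult \<mu> i p" "p 0 e"
    by (rule transferred_dg_algebra)
  show ?thesis
    by unfold_locales (simp_all add: i_p_unit transferred_mult_def i_p_mult)
qed

end

theorem proposition1p4:
  fixes R :: "('a, 'm) ring_scheme" and X :: "('a, 'x) cplx" and Y :: "('a, 'y) cplx"
  assumes "cring R"
    and "dg_algebra R X \<mu> e"
    and "deformation_retract R X Y i p h"
    and "generalized_leibniz X \<mu> h"
    and "\<And>n y. y \<in> carrier (deg Y n) \<Longrightarrow> h n (i n y) = \<zero>\<^bsub>deg X (n + 1)\<^esub>"
    and "h 0 e = \<zero>\<^bsub>deg X 1\<^esub>"
  shows "dg_algebra R Y (transferred_mult \<mu> i p) (p 0 e) \<and>
    dg_algebra_hom R Y (transferred_mult \<mu> i p) (p 0 e) X \<mu> e i"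
proof -
  interpret X: dg_algebra R X \<mu> e by fact
  interpret deformation_retract R X Y i p h by fact
  interpret M: module R "deg X n" for n by (rule X.deg_module)
  note h_zero = lin_hom_zero[OF h_hom X.deg_module X.deg_module]
  note dif_zero = lin_hom_zero[OF X.dif_hom X.deg_module X.deg_module]
  \<comment> \<open>Both correction terms in \<open>i p = 1 + d h + h d\<close> vanish at such an
    \<open>x\<close>.\<close>
  have i_p_fixed: "i n (p n x) = x"
    if "x \<in> carrier (deg X n)" "h n x = \<zero>\<^bsub>deg X (n + 1)\<^esub>" "h (n - 1) (dif X n x) = \<zero>\<^bsub>deg X n\<^esub>"
    for n x
    using that dif_zero[of "n + 1"] by (simp add: i_p)
  have h_mult: "h (m + n) (\<mu> m n (i m a) (i n b)) = \<zero>\<^bsub>deg X (m + n + 1)\<^esub>"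
    if a: "a \<in> carrier (deg Y m)" and b: "b \<in> carrier (deg Y n)" for m n a b
  proof -
    \<comment> \<open>The cofactors \<open>u\<close> and \<open>v\<close> are arbitrary: they
      multiply \<open>h (i a)\<close> and \<open>h (i b)\<close>, which are zero.\<close>
    obtain u v where uv: "u \<in> carrier (deg X n)" "v \<in> carrier (deg X m)"
      and eq: "h (m + n) (\<mu> m n (i m a) (i n b)) =
        \<mu> (m + 1) n (h m (i m a)) u \<oplus>\<^bsub>deg X (m + n + 1)\<^esub> \<mu> m (n + 1) v (h n (i n b))"
      using assms(4) i.map_closed[OF a] i.map_closed[OF b]
      unfolding generalized_leibniz_def by blast
    have idx: "m + 1 + n = m + n + 1" "m + (n + 1) = m + n + 1" by auto
    show ?thesis
      unfolding eq assms(5)[OF a] assms(5)[OF b] X.mult_zero_left[OF uv(1)]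
        X.mult_zero_right[OF uv(2)] idx
      by simp
  qed
  \<comment> \<open>By the Leibniz rule and the chain map property of \<open>i\<close>, the
    differential of \<open>i(a) i(b)\<close> is again a signed sum of products of elements from the
    image of \<open>i\<close>, so \<open>h_mult\<close> applies to each summand.\<close>
  have h_dif_mult: "h (m + n - 1) (dif X (m + n) (\<mu> m n (i m a) (i n b))) = \<zero>\<^bsub>deg X (m + n)\<^esub>"
    if a: "a \<in> carrier (deg Y m)" and b: "b \<in> carrier (deg Y n)" for m n a b
  proof -
    let ?k = "m + n - 1"
    have idx: "m - 1 + n = ?k" "m + (n - 1) = ?k" "?k + 1 = m + n" by auto
    have da: "dif Y m a \<in> carrier (deg Y (m - 1))" and db: "dif Y n b \<in> carrier (deg Y (n - 1))"
      using a b by (auto intro: i.X.dif_closed)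
    let ?s = "\<mu> (m - 1) n (i (m - 1) (dif Y m a)) (i n b)"
    let ?t = "\<mu> m (n - 1) (i m a) (i (n - 1) (dif Y n b))"
    have s: "?s \<in> carrier (deg X ?k)" "h ?k ?s = \<zero>\<^bsub>deg X (m + n)\<^esub>"
      using X.mult_closed[OF i.map_closed[OF da] i.map_closed[OF b]] h_mult[OF da b]
      unfolding idx by auto
    have t: "?t \<in> carrier (deg X ?k)" "h ?k ?t = \<zero>\<^bsub>deg X (m + n)\<^esub>"
      using X.mult_closed[OF i.map_closed[OF a] i.map_closed[OF db]] h_mult[OF a db]
      unfolding idx by auto
    have hk: "h ?k \<in> lin_hom R (deg X ?k) (deg X (m + n))"
      using h_hom[of ?k] unfolding idx .
    have "dif X (m + n) (\<mu> m n (i m a) (i n b)) = ?s \<oplus>\<^bsub>deg X ?k\<^esub> ksign (deg X ?k) m ?t"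
      using a b by (simp add: X.leibniz i.map_closed i.map_dif)
    then show ?thesis
      using s t
      by (simp add: lin_hom_add[OF hk] lin_hom_ksign[OF hk X.deg_module X.deg_module]
          ksign_closed[OF X.deg_module] ksign_zero[OF X.deg_module])
  qed
  have "dif X 0 e = \<zero>\<^bsub>deg X (- 1)\<^esub>"
    using X.dif_closed[OF X.unit_closed] X.nonneg[of "- 1"] by auto
  \<comment> \<open>Here \<open>h 0 e = 0\<close> is used; the other correction term vanishes
    because \<open>e\<close> is a cycle, \<open>X\<close> being zero in degree -1.\<close>
  then have i_p_unit: "i 0 (p 0 e) = e"
    using i_p_fixed[OF X.unit_closed] assms(6) h_zero[of "- 1"] by simp
  interpret dg_algebra_section R X \<mu> e Y i p
    by unfold_locales
      (simp_all add: p_i i_p_unit i_p_fixed X.mult_closed i.map_closed h_mult h_dif_mult)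
  show ?thesis using transferred_dg_algebra section_dg_algebra_hom by blast
qed

end
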